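(* Let $\Omega=(0,1)\times(0,1)$ and let the diffusion matrix $\mathbb{D}=\begin{bmatrix} a & b\\ b& c\end{bmatrix}$ be continuous on $\overline{\Omega}$ and symmetric and uniformly positive definite on $\Omega$. Consider the boundary value problem $-\nabla\cdot(\mathbb{D}\nabla u)=f$ in $\Omega$, $u=g$ on $\partial\Omega$, and the uniform mesh $(x_j,y_k)=(jh,kh)$, $j,k=0,\dots,N$, $h=1/N$. If $h$ is sufficiently small (i.e. there is $h_0>0$ such that this holds for all such $h\le h_0$), then a monotone finite difference scheme exists for this problem and can be constructed based on central (directional) finite differences; that is, the stencil half-widths $m_{j,k}$ and the directions $\beta_1,\beta_2$ at each interior mesh point can be chosen so that the resulting central directional finite difference scheme (as defined in the context) is monotone.
   Context: Uniformly positive definite on $\Omega$ means there is $\lambda>0$ with $\xi^T\mathbb{D}(x,y)\xi\ge\lambda|\xi|^2$ for all $\xi\in\mathbb{R}^2$, $(x,y)\in\Omega$. Define $$\overline{\alpha}=\inf_\Omega(ac-b^2),\qquad \alpha=\max\Big(\sup_\Omega a(|b|+1),\ \sup_\Omega c(|b|+1)\Big),$$ and let $[x]$ be the largest integer $\le x$. Central directional finite difference scheme. At each interior mesh point $P=(x_j,y_k)$, $1\le j,k\le N-1$, one chooses an integer $m_{j,k}$ with $1\le m_{j,k}\le[3\alpha/\overline{\alpha}]+1$ (the stencil $\omega_{j,k}$ has size $(2m_{j,k}+1)\times(2m_{j,k}+1)$ and is centered at $P$), and angles $\beta_1\in(0,\pi/2)$, $\beta_2\in(-\pi/2,0)$ (which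 may depend on $(j,k)$) such that $\tan\beta_i=q_i/p_i$ with integers $1\le p_i\le m_{j,k}$, $1\le |q_i|\le m_{j,k}$; so the line through $P$ of slope $\tan\beta_i$ contains the two further stencil points $P\pm(p_ih,q_ih)$. Put $$\gamma_0=\begin{cases} a-b\cot\beta_1, & b\ge 0\\ a-b\cot\beta_2, & b<0\end{cases}\quad \gamma_1^+=\begin{cases}\frac{b}{\cos\beta_1\sin\beta_1}, & b\ge 0\\ 0, & b<0\end{cases}\quad \gamma_1^-=\begin{cases}0, & b\ge 0\\ \frac{b}{\cos\beta_2\sin\beta_2}, & b<0\end{cases}\quad \gamma_2=\begin{cases} c-b\tan\beta_1, & b\ge 0\\ c-b\tan\beta_2, & b<0\end{cases}$$ With $\partial_\beta=\cos\beta\,\partial_x+\sin\beta\,\partial_y$, the operator is split as $$\nabla\cdot(\mathbb{D}\nabla u)=\partial_x(\gamma_0\partial_xu)+\partial_{\beta_1}(\gamma_1^+\partial_{\beta_1}u)+\partial_{\beta_2}(\gamma_1^-\partial_{\beta_2}u)+\partial_y(\gamma_2\partial_yu)\quad\text{at }P,$$ and each term $\partial_e(\gamma\,\partial_eu)(P)$, with $e$ the corresponding unit direction, is replaced by the three-point central difference $$\frac{2}{s_++s_-}\left[\gamma\!\left(P+\tfrac{s_+}{2}e\right)\frac{u(P+s_+e)-u(P)}{s_+}-\gamma\!\left(P-\tfrac{s_-}{2}e\right)\frac{u(P)-u(P-s_-e)}{s_-}\right].$$ For the $x$- and $y$-terms $s_\pm=h$. For the $\beta_i$-term, $P\pm s_\pm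 e=P\pm(p_ih,q_ih)$ if this mesh point lies in $\overline{\Omega}$; otherwise $P\pm s_\pm e$ is the point where the ray from $P$ in direction $\pm e$ meets $\partial\Omega$. Values of $u$ at points of $\partial\Omega$ are given by $g$; the unknowns are the values at interior mesh points, and the equation at $P$ is that minus the sum of the four difference expressions equals $f(P)$. The scheme is called monotone if the coefficient matrix of the resulting linear system for the interior unknowns is an $M$-matrix (nonpositive off-diagonal entries, nonsingular, entrywise nonnegative inverse). *)

theory Defs
  imports "HOL-Analysis.Analysis"
begin

definition Omega :: "(real \<times> real) set" where
  "Omega = {0<..<1} \<times> {0<..<1}"

definition uniformly_pos_def_on :: "(real \<times> real) set \<Rightarrow> (real \<times> real \<Rightarrow> real^2^2) \<Rightarrow> bool" where
  "uniformly_pos_def_on S D \<longleftrightarrow>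
     (\<exists>l>0. \<forall>X\<in>S. \<forall>\<xi>::real^2. \<xi> \<bullet> (D X *v \<xi>) \<ge> l * (norm \<xi>)\<^sup>2)"

definition coeff_a :: "(real \<times> real \<Rightarrow> real^2^2) \<Rightarrow> real \<times> real \<Rightarrow> real" where
  "coeff_a D X = D X $ 1 $ 1"

definition coeff_b :: "(real \<times> real \<Rightarrow> real^2^2) \<Rightarrow> real \<times> real \<Rightarrow> real" where
  "coeff_b D X = D X $ 1 $ 2"

definition coeff_c :: "(real \<times> real \<Rightarrow> real^2^2) \<Rightarrow> real \<times> real \<Rightarrow> real" where
  "coeff_c D X = D X $ 2 $ 2"

definition alpha_lower :: "(real \<times> real \<Rightarrow> real^2^2) \<Rightarrow> real" where
  "alpha_lower D = (INF X\<in>Omega. coeff_a D X * coeff_c D X - (coeff_b D X)\<^sup>2)"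

definition alpha_upper :: "(real \<times> real \<Rightarrow> real^2^2) \<Rightarrow> real" where
  "alpha_upper D = max (SUP X\<in>Omega. coeff_a D X * (\<bar>coeff_b D X\<bar> + 1))
                       (SUP X\<in>Omega. coeff_c D X * (\<bar>coeff_b D X\<bar> + 1))"

text \<open>Interior mesh points are represented by their coordinates, and functions of the index pair
  \<open>(j, k)\<close> by functions of the corresponding point.\<close>

definition interior_mesh :: "nat \<Rightarrow> (real \<times> real) set" where
  "interior_mesh N = {(real j / real N, real k / real N) | j k. 1 \<le> j \<and> j < N \<and> 1 \<le> k \<and> k < N}"

text \<open>The data chosen at one mesh point. The integers \<open>p\<^sub>i, q\<^sub>i\<close> belong to the choice: they are not
  determined by the angle, since they need not be coprime.\<close>

record stencil =
  width :: nat
  angle1 :: real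
  angle2 :: real
  run1 :: int
  rise1 :: int
  run2 :: int
  rise2 :: int

definition admissible_stencil :: "(real \<times> real \<Rightarrow> real^2^2) \<Rightarrow> stencil \<Rightarrow> bool" where
  "admissible_stencil D s \<longleftrightarrow>
     1 \<le> width s \<and> int (width s) \<le> \<lfloor>3 * alpha_upper D / alpha_lower D\<rfloor> + 1 \<and>
     0 < angle1 s \<and> angle1 s < pi / 2 \<and>
     - pi / 2 < angle2 s \<and> angle2 s < 0 \<and>
     1 \<le> run1 s \<and> run1 s \<le> int (width s) \<and> 1 \<le> \<bar>rise1 s\<bar> \<and> \<bar>rise1 s\<bar> \<le> int (width s) \<and>
     tan (angle1 s) = of_int (rise1 s) / of_int (run1 s) \<and>
     1 \<le> run2 s \<and> run2 s \<le> int (width s) \<and> 1 \<le> \<bar>rise2 s\<bar> \<and> \<bar>rise2 s\<bar> \<le> int (width s) \<and>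
     tan (angle2 s) = of_int (rise2 s) / of_int (run2 s)"

definition gamma0 :: "(real \<times> real \<Rightarrow> real^2^2) \<Rightarrow> stencil \<Rightarrow> real \<times> real \<Rightarrow> real" where
  "gamma0 D s X = (if coeff_b D X \<ge> 0 then coeff_a D X - coeff_b D X * cot (angle1 s)
                   else coeff_a D X - coeff_b D X * cot (angle2 s))"

definition gamma1_plus :: "(real \<times> real \<Rightarrow> real^2^2) \<Rightarrow> stencil \<Rightarrow> real \<times> real \<Rightarrow> real" where
  "gamma1_plus D s X =
     (if coeff_b D X \<ge> 0 then coeff_b D X / (cos (angle1 s) * sin (angle1 s)) else 0)"

definition gamma1_minus :: "(real \<times> real \<Rightarrow> real^2^2) \<Rightarrow> stencil \<Rightarrow> real \<times> real \<Rightarrow> real" where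
  "gamma1_minus D s X =
     (if coeff_b D X \<ge> 0 then 0 else coeff_b D X / (cos (angle2 s) * sin (angle2 s)))"

definition gamma2 :: "(real \<times> real \<Rightarrow> real^2^2) \<Rightarrow> stencil \<Rightarrow> real \<times> real \<Rightarrow> real" where
  "gamma2 D s X = (if coeff_b D X \<ge> 0 then coeff_c D X - coeff_b D X * tan (angle1 s)
                   else coeff_c D X - coeff_b D X * tan (angle2 s))"

definition direction :: "real \<Rightarrow> real \<times> real" where
  "direction \<beta> = (cos \<beta>, sin \<beta>)"

text \<open>\<open>central_diff \<gamma> e sp sm v P\<close> approximates \<open>\<partial>\<^sub>e (\<gamma> \<partial>\<^sub>e v)\<close> at \<open>P\<close>,
  with step \<open>sp\<close> along \<open>e\<close> and step \<open>sm\<close> along \<open>-e\<close>.\<close>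

definition central_diff ::
  "(real \<times> real \<Rightarrow> real) \<Rightarrow> real \<times> real \<Rightarrow> real \<Rightarrow> real \<Rightarrow> (real \<times> real \<Rightarrow> real) \<Rightarrow> real \<times> real \<Rightarrow> real"
where
  "central_diff \<gamma> e sp sm v P =
     2 / (sp + sm) *
       (\<gamma> (P + (sp / 2) *\<^sub>R e) * ((v (P + sp *\<^sub>R e) - v P) / sp)
        - \<gamma> (P - (sm / 2) *\<^sub>R e) * ((v P - v (P - sm *\<^sub>R e)) / sm))"

text \<open>Step from \<open>P\<close> in the unit direction \<open>e\<close> towards \<open>P + d\<close>, where \<open>d\<close> is a positive multiple of
  \<open>e\<close>: the full length of \<open>d\<close> if \<open>P + d\<close> is in the closed square, else the distance along the ray to
  the boundary. Since \<open>P\<close> is interior and the square is convex, the ray meets the boundary in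
  exactly one point.\<close>

definition step_length :: "real \<times> real \<Rightarrow> real \<times> real \<Rightarrow> real \<times> real \<Rightarrow> real" where
  "step_length P e d =
     (if P + d \<in> closure Omega then norm d
      else (THE t. 0 < t \<and> P + t *\<^sub>R e \<in> frontier Omega))"

definition directional_diff ::
  "real \<Rightarrow> (real \<times> real \<Rightarrow> real) \<Rightarrow> real \<Rightarrow> int \<Rightarrow> int \<Rightarrow> (real \<times> real \<Rightarrow> real) \<Rightarrow> real \<times> real \<Rightarrow> real"
where
  "directional_diff h \<gamma> \<beta> p q v P =
     (let e = direction \<beta>; d = (of_int p * h, of_int q * h)
      in central_diff \<gamma> e (step_length P e d) (step_length P (- e) (- d)) v P)"

definition with_boundary_values ::
  "(real \<times> real \<Rightarrow> real) \<Rightarrow> (real \<times> real \<Rightarrow> real) \<Rightarrow> real \<times> real \<Rightarrow> real" where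
  "with_boundary_values g u X = (if X \<in> frontier Omega then g X else u X)"

text \<open>The equation of the scheme at \<open>P\<close> is \<open>scheme_lhs D g N S u P = f P\<close>; the unknowns are the
  values of \<open>u\<close> on \<open>interior_mesh N\<close>.\<close>

definition scheme_lhs ::
  "(real \<times> real \<Rightarrow> real^2^2) \<Rightarrow> (real \<times> real \<Rightarrow> real) \<Rightarrow> nat \<Rightarrow> (real \<times> real \<Rightarrow> stencil) \<Rightarrow>
   (real \<times> real \<Rightarrow> real) \<Rightarrow> real \<times> real \<Rightarrow> real"
where
  "scheme_lhs D g N S u P =
     (let h = 1 / real N; s = S P; v = with_boundary_values g u
      in - (central_diff (gamma0 D s) (1, 0) h h v P
            + directional_diff h (gamma1_plus D s) (angle1 s) (run1 s) (rise1 s) v P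
            + directional_diff h (gamma1_minus D s) (angle2 s) (run2 s) (rise2 s) v P
            + central_diff (gamma2 D s) (0, 1) h h v P))"

text \<open>\<open>A u = r\<close> is the linear system formed by the equations at all interior mesh points, with the
  boundary terms moved into \<open>r\<close>. Requiring the two residuals to agree for all \<open>u\<close>, instead of only
  the solution sets, fixes the scaling of each row, so that \<open>A\<close> is unique on the interior mesh.\<close>

definition is_linear_system ::
  "(real \<times> real \<Rightarrow> real^2^2) \<Rightarrow> (real \<times> real \<Rightarrow> real) \<Rightarrow> (real \<times> real \<Rightarrow> real) \<Rightarrow> nat \<Rightarrow>
   (real \<times> real \<Rightarrow> stencil) \<Rightarrow> (real \<times> real \<Rightarrow> real \<times> real \<Rightarrow> real) \<Rightarrow> (real \<times> real \<Rightarrow> real) \<Rightarrow> bool"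
where
  "is_linear_system D f g N S A r \<longleftrightarrow>
     (\<forall>u. \<forall>P\<in>interior_mesh N.
        scheme_lhs D g N S u P - f P = (\<Sum>Q\<in>interior_mesh N. A P Q * u Q) - r P)"

text \<open>Square matrices with rows and columns indexed by a finite set \<open>I\<close>.\<close>

definition is_inverse_on :: "'i set \<Rightarrow> ('i \<Rightarrow> 'i \<Rightarrow> real) \<Rightarrow> ('i \<Rightarrow> 'i \<Rightarrow> real) \<Rightarrow> bool" where
  "is_inverse_on I A B \<longleftrightarrow>
     (\<forall>i\<in>I. \<forall>k\<in>I. (\<Sum>j\<in>I. A i j * B j k) = (if i = k then 1 else 0) \<and>
                   (\<Sum>j\<in>I. B i j * A j k) = (if i = k then 1 else 0))"

definition M_matrix_on :: "'i set \<Rightarrow> ('i \<Rightarrow> 'i \<Rightarrow> real) \<Rightarrow> bool" where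
  "M_matrix_on I A \<longleftrightarrow>
     (\<forall>i\<in>I. \<forall>j\<in>I. i \<noteq> j \<longrightarrow> A i j \<le> 0) \<and>
     (\<exists>B. is_inverse_on I A B \<and> (\<forall>i\<in>I. \<forall>j\<in>I. 0 \<le> B i j))"

definition monotone_scheme ::
  "(real \<times> real \<Rightarrow> real^2^2) \<Rightarrow> (real \<times> real \<Rightarrow> real) \<Rightarrow> (real \<times> real \<Rightarrow> real) \<Rightarrow> nat \<Rightarrow>
   (real \<times> real \<Rightarrow> stencil) \<Rightarrow> bool"
where
  "monotone_scheme D f g N S \<longleftrightarrow>
     (\<exists>A r. is_linear_system D f g N S A r \<and> M_matrix_on (interior_mesh N) A)"

end

theory Submission
  imports Defs "Jordan_Normal_Form.Determinant"
begin

text \<open>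
  The difference scheme is monotone because every equation says that a nonnegatively weighted sum of
  drops \<open>v P - v Y\<close> equals \<open>f P\<close>, where each \<open>Y\<close> is an interior mesh point or a boundary point.
  Such a system obeys a minimum principle: at an interior point where \<open>v\<close> attains a negative minimum
  all the drops are at most zero, and if the neighbour one step to the left has positive weight, then
  the leftmost such minimiser has a strictly negative drop. So with zero boundary values
  a nonnegative right-hand side forces a nonnegative solution. For a square system this gives both invertibility and the sign of the
  inverse, and hence an M-matrix (\<open>weighted_drop_M_matrix\<close>).

  The weights are positive multiples of values of the split coefficients at half steps. Both mixed coefficients are
  nonnegative everywhere, since the sign of \<open>b\<close> selects the direction in which it is used. If the
  two directions have slopes \<open>q / p\<close> and \<open>- q / p\<close>, then the axis coefficients are
  \<open>a - \<bar>b\<bar> p / q\<close> and \<open>c - \<bar>b\<bar> q / p\<close> whatever the sign of \<open>b\<close>, so monotonicity is reduced to finding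
  integers between \<open>1\<close> and the bound \<open>M\<close> on the stencil half-width with
  \<open>\<bar>b\<bar> / a < q / p < c / \<bar>b\<bar>\<close>. They exist at every single point: unless this interval contains \<open>1\<close>,
  the determinant bound makes it, or the interval of the reciprocals, a subset of \<open>(0, 1]\<close> wider than
  \<open>1 / M\<close> (\<open>rational_slope_exists\<close>).

  The half steps do not lie at the mesh point itself. For each of the finitely many pairs \<open>(p, q)\<close>
  the strict inequalities hold on a relatively open set, and these sets cover the compact closed
  square. A Lebesgue number of the cover is a radius on which one pair works around each point
  (\<open>uniform_slope_choice\<close>); it is the required bound on the mesh size.
\<close>

section \<open>M-matrices from weighted differences\<close>

text \<open>An enumeration of the index set turns the family into a square matrix over a field. There
  a nontrivial kernel is the only obstruction to a nonzero determinant.\<close>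

lemma trivial_kernel_imp_inverse_on:
  fixes A :: "'i \<Rightarrow> 'i \<Rightarrow> real"
  assumes fin: "finite I"
    and ker: "\<And>u. (\<forall>i\<in>I. (\<Sum>j\<in>I. A i j * u j) = 0) \<Longrightarrow> \<forall>i\<in>I. u i = 0"
  obtains B where "is_inverse_on I A B"
proof -
  define n where "n = card I"
  obtain e where e: "bij_betw e {0..<n} I"
    using ex_bij_betw_nat_finite[OF fin] n_def by auto
  define d where "d = inv_into {0..<n} e"
  have de: "d (e k) = k" if "k < n" for k
    using e that by (simp add: d_def bij_betw_inv_into_left)
  have ed: "e (d i) = i" and dn: "d i < n" if "i \<in> I" for i
    using bij_betw_inv_into_right[OF e that] bspec[OF bij_betwE[OF bij_betw_inv_into[OF e]] that]
    by (simp_all add: d_def)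
  have eI: "e k \<in> I" if "k < n" for k
    using bspec[OF bij_betwE[OF e], of k] that by simp
  have sumI: "(\<Sum>i\<in>I. F i) = (\<Sum>k = 0..<n. F (e k))" for F :: "'i \<Rightarrow> real"
    using sum.reindex_bij_betw[OF e, of F] by simp
  define M where "M = mat n n (\<lambda>(i, j). A (e i) (e j))"
  have M: "M \<in> carrier_mat n n"
    by (simp add: M_def)
  have "det M \<noteq> 0"
  proof
    assume "det M = 0"
    then obtain v where v: "v \<in> carrier_vec n" "v \<noteq> 0\<^sub>v n" "M *\<^sub>v v = 0\<^sub>v n"
      using det_0_iff_vec_prod_zero_field[OF M] by blast
    define u where "u i = vec_index v (d i)" for i
    have "(\<Sum>j\<in>I. A i j * u j) = 0" if i: "i \<in> I" for i
    proof -
      have "vec_index (M *\<^sub>v v) (d i) = 0"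
        using v(3) dn[OF i] by simp
      then show ?thesis
        using v(1) dn[OF i] by (simp add: M_def scalar_prod_def sumI u_def de ed[OF i])
    qed
    then have u0: "u i = 0" if "i \<in> I" for i
      using ker that by blast
    have "vec_index v k = 0" if "k < n" for k
      using u0[OF eI[OF that]] by (simp add: u_def de[OF that])
    then have "v = 0\<^sub>v n"
      using v(1) by (intro eq_vecI) auto
    with v(2) show False ..
  qed
  then have "M \<in> Units (ring_mat TYPE(real) n ())"
    by (rule det_non_zero_imp_unit[OF M])
  then obtain N where N: "N \<in> carrier_mat n n" "N * M = 1\<^sub>m n" "M * N = 1\<^sub>m n"
    unfolding Units_def by (simp add: ring_mat_simps) blast
  define B where "B i j = N $$ (d i, d j)" for i j
  have "(\<Sum>j\<in>I. A i j * B j k) = (if i = k then 1 else 0) \<and>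
        (\<Sum>j\<in>I. B i j * A j k) = (if i = k then 1 else 0)" if ik: "i \<in> I" "k \<in> I" for i k
  proof -
    have bounds: "d i < n" "d k < n" and inj: "d i = d k \<longleftrightarrow> i = k"
      using dn[OF ik(1)] dn[OF ik(2)] ed[OF ik(1)] ed[OF ik(2)] by metis+
    have one: "(1\<^sub>m n :: real mat) $$ (d i, d k) = (if i = k then 1 else 0)"
      using bounds inj by simp
    have "(M * N) $$ (d i, d k) = (\<Sum>j\<in>I. A i j * B j k)"
      using N(1) bounds
      by (simp add: M_def scalar_prod_def sumI B_def de ed[OF ik(1)])
    moreover have "(N * M) $$ (d i, d k) = (\<Sum>j\<in>I. B i j * A j k)"
      using N(1) bounds
      by (simp add: M_def scalar_prod_def sumI B_def de ed[OF ik(2)])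
    ultimately show ?thesis
      using one N(2,3) by simp
  qed
  then have "is_inverse_on I A B"
    unfolding is_inverse_on_def by (intro ballI)
  then show thesis ..
qed

text \<open>Inverse positivity applied to \<open>u\<close> and \<open>- u\<close> makes the kernel trivial. The columns of the inverse
  solve the system with unit vectors on the right, and are therefore nonnegative.\<close>

lemma M_matrix_on_if_inverse_positive:
  assumes fin: "finite I"
    and off: "\<And>i j. i \<in> I \<Longrightarrow> j \<in> I \<Longrightarrow> i \<noteq> j \<Longrightarrow> A i j \<le> 0"
    and pos: "\<And>u. \<forall>i\<in>I. 0 \<le> (\<Sum>j\<in>I. A i j * u j) \<Longrightarrow> \<forall>i\<in>I. 0 \<le> u i"
  shows "M_matrix_on I A"
proof -
  have ker: "\<forall>i\<in>I. u i = 0" if u: "\<forall>i\<in>I. (\<Sum>j\<in>I. A i j * u j) = 0" for u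
  proof -
    have "\<forall>i\<in>I. 0 \<le> u i" "\<forall>i\<in>I. 0 \<le> - u i"
      using pos[of u] pos[of "\<lambda>i. - u i"] u by (simp_all add: sum_negf)
    then show ?thesis by force
  qed
  obtain B where B: "is_inverse_on I A B"
    using trivial_kernel_imp_inverse_on[OF fin ker] by blast
  have "0 \<le> B i k" if "i \<in> I" "k \<in> I" for i k
    using pos[of "\<lambda>j. B j k"] B that by (simp add: is_inverse_on_def)
  with B off show ?thesis
    unfolding M_matrix_on_def by (intro conjI ballI impI exI[of _ B])
qed

text \<open>A row of the scheme before boundary values are separated from unknowns. Lists are used so that the
  rows of the four difference expressions can be concatenated, even if they share neighbours.\<close>

definition weighted_drop :: "(real \<times> 'p) list \<Rightarrow> ('p \<Rightarrow> real) \<Rightarrow> 'p \<Rightarrow> real" where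
  "weighted_drop ws v P = (\<Sum>(w, Y)\<leftarrow>ws. w * (v P - v Y))"

lemma weighted_drop_Nil [simp]: "weighted_drop [] v P = 0"
  and weighted_drop_Cons [simp]:
    "weighted_drop ((w, Y) # ws) v P = w * (v P - v Y) + weighted_drop ws v P"
  and weighted_drop_append [simp]:
    "weighted_drop (ws @ ws') v P = weighted_drop ws v P + weighted_drop ws' v P"
  by (simp_all add: weighted_drop_def)

lemma weighted_drop_diff:
  "weighted_drop ws (\<lambda>X. u X - v X) P = weighted_drop ws u P - weighted_drop ws v P"
  by (induction ws) (auto simp: algebra_simps)

lemma weighted_drop_nonpos:
  assumes "\<And>w Y. (w, Y) \<in> set ws \<Longrightarrow> 0 \<le> w \<and> v P \<le> v Y"
  shows "weighted_drop ws v P \<le> 0"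
  using assms
proof (induction ws)
  case (Cons a ws)
  obtain w Y where a: "a = (w, Y)" by force
  have "w * (v P - v Y) \<le> 0"
    using Cons.prems[of w Y] by (simp add: a mult_nonneg_nonpos)
  moreover have "weighted_drop ws v P \<le> 0"
    by (rule Cons.IH) (use Cons.prems in auto)
  ultimately show ?case
    by (simp add: a)
qed simp

lemma weighted_drop_neg:
  assumes "\<And>w Y. (w, Y) \<in> set ws \<Longrightarrow> 0 \<le> w \<and> v P \<le> v Y"
    and "(w, Y) \<in> set ws" "0 < w" "v P < v Y"
  shows "weighted_drop ws v P < 0"
proof -
  obtain xs ys where ws: "ws = xs @ (w, Y) # ys"
    using assms(2) by (meson split_list)
  have "weighted_drop xs v P \<le> 0" "weighted_drop ys v P \<le> 0"
    using assms(1) by (auto intro!: weighted_drop_nonpos simp: ws)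
  moreover have "w * (v P - v Y) < 0"
    using assms(3,4) by (simp add: mult_pos_neg)
  ultimately show ?thesis
    by (simp add: ws)
qed

text \<open>A weighted drop is linear in the function, so the drops of the indicator functions are its matrix
  entries. Only values on \<open>I\<close> enter: the matrix acts as the drop of the extension by zero.\<close>

lemma weighted_drop_matrix_apply:
  assumes "finite I"
  shows "(\<Sum>Q\<in>I. weighted_drop ws (indicator {Q}) P * u Q) =
         weighted_drop ws (\<lambda>X. indicator I X * u X) P"
proof (induction ws)
  case (Cons a ws)
  obtain w Y where a: "a = (w, Y)" by force
  have ind: "(\<Sum>Q\<in>I. indicator {Q} X * u Q) = indicator I X * u X" for X
    using assms by (simp add: indicator_def if_distrib[where f = "\<lambda>x. x * _"] cong: if_cong)
  have "(\<Sum>Q\<in>I. weighted_drop (a # ws) (indicator {Q}) P * u Q) =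
      w * ((\<Sum>Q\<in>I. indicator {Q} P * u Q) - (\<Sum>Q\<in>I. indicator {Q} Y * u Q)) +
      (\<Sum>Q\<in>I. weighted_drop ws (indicator {Q}) P * u Q)"
    by (simp add: a sum_distrib_left sum.distrib sum_subtractf algebra_simps)
  then show ?case
    using Cons by (simp add: a ind)
qed simp

text \<open>The rank \<open>rk\<close> replaces a connectivity argument. From a minimiser of least rank, the neighbour of
  lower rank or outside \<open>I\<close> has a strictly larger value, while no neighbour has a smaller one.\<close>

lemma weighted_drop_minimum_principle:
  fixes rk :: "'p \<Rightarrow> real"
  assumes fin: "finite I"
    and nonneg: "\<And>P w Y. P \<in> I \<Longrightarrow> (w, Y) \<in> set (ws P) \<Longrightarrow> 0 \<le> w"
    and exit: "\<And>P. P \<in> I \<Longrightarrow> \<exists>w Y. (w, Y) \<in> set (ws P) \<and> 0 < w \<and> (Y \<in> I \<longrightarrow> rk Y < rk P)"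
    and zero: "\<And>X. X \<notin> I \<Longrightarrow> v X = 0"
    and super: "\<And>P. P \<in> I \<Longrightarrow> 0 \<le> weighted_drop (ws P) v P"
  shows "\<forall>P\<in>I. 0 \<le> v P"
proof (rule ccontr)
  assume "\<not> (\<forall>P\<in>I. 0 \<le> v P)"
  then obtain P0 where P0: "P0 \<in> I" "v P0 < 0" by force
  define m where "m = Min (v ` I)"
  have m_le: "m \<le> v X" if "X \<in> I" for X
    using that fin by (simp add: m_def)
  have "m < 0"
    using m_le[OF P0(1)] P0(2) by simp
  define J where "J = {X \<in> I. v X = m}"
  have "m \<in> v ` I"
    unfolding m_def using fin P0(1) by (intro Min_in) auto
  then have J: "finite J" "J \<noteq> {}"
    using fin by (auto simp: J_def)
  obtain P where P: "P \<in> J" "\<And>X. X \<in> J \<Longrightarrow> rk P \<le> rk X"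
    using ex_min_if_finite[of "rk ` J"] J by (auto simp: not_less)
  then have PI: "P \<in> I" "v P = m"
    by (auto simp: J_def)
  obtain w Y where wY: "(w, Y) \<in> set (ws P)" "0 < w" "Y \<in> I \<longrightarrow> rk Y < rk P"
    using exit[OF PI(1)] by blast
  have "v P < v Y"
  proof (cases "Y \<in> I")
    case True
    then have "Y \<notin> J"
      using P(2)[of Y] wY(3) by auto
    then show ?thesis
      using True m_le[OF True] PI by (auto simp: J_def)
  qed (use zero \<open>m < 0\<close> PI in auto)
  moreover have "v P \<le> v X" for X
    using m_le[of X] zero[of X] PI \<open>m < 0\<close> by (cases "X \<in> I") auto
  ultimately have "weighted_drop (ws P) v P < 0"
    using nonneg[OF PI(1)] wY by (intro weighted_drop_neg) auto
  with super[OF PI(1)] show False by simp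
qed

text \<open>The matrix is weakly diagonally dominant, and every index is joined to one outside \<open>I\<close> by a chain
  of positive weights along which the rank decreases; the minimum principle then yields inverse
  positivity.\<close>

lemma weighted_drop_M_matrix:
  fixes rk :: "'p \<Rightarrow> real"
  assumes fin: "finite I"
    and nonneg: "\<And>P w Y. P \<in> I \<Longrightarrow> (w, Y) \<in> set (ws P) \<Longrightarrow> 0 \<le> w"
    and exit: "\<And>P. P \<in> I \<Longrightarrow> \<exists>w Y. (w, Y) \<in> set (ws P) \<and> 0 < w \<and> (Y \<in> I \<longrightarrow> rk Y < rk P)"
  shows "M_matrix_on I (\<lambda>P Q. weighted_drop (ws P) (indicator {Q}) P)"
proof (rule M_matrix_on_if_inverse_positive[OF fin])
  show "weighted_drop (ws P) (indicator {Q}) P \<le> 0" if "P \<in> I" "Q \<in> I" "P \<noteq> Q" for P Q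
    using that nonneg[OF that(1)] by (intro weighted_drop_nonpos) auto
next
  fix u :: "'p \<Rightarrow> real"
  assume "\<forall>P\<in>I. 0 \<le> (\<Sum>Q\<in>I. weighted_drop (ws P) (indicator {Q}) P * u Q)"
  then have super: "0 \<le> weighted_drop (ws P) (\<lambda>X. indicator I X * u X) P" if "P \<in> I" for P
    using that by (simp add: weighted_drop_matrix_apply[OF fin])
  have "\<forall>P\<in>I. 0 \<le> indicator I P * u P"
    by (rule weighted_drop_minimum_principle[where rk = rk and ws = ws, OF fin])
      (auto intro: nonneg super dest: exit)
  then show "\<forall>P\<in>I. 0 \<le> u P"
    by simp
qed

section \<open>Central differences on the mesh of the unit square\<close>

lemma closure_Omega: "closure Omega = {0..1} \<times> {0..1}"
  by (simp add: Omega_def closure_Times)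

lemma open_Omega: "open Omega"
  by (simp add: Omega_def open_Times)

lemma frontier_Omega: "frontier Omega = closure Omega - Omega"
  by (simp add: frontier_def interior_open open_Omega)

lemma interior_mesh_subset_Omega: "interior_mesh N \<subseteq> Omega"
  by (auto simp: interior_mesh_def Omega_def)

lemma finite_interior_mesh: "finite (interior_mesh N)"
proof (rule finite_subset)
  show "interior_mesh N \<subseteq> (\<lambda>(j, k). (real j / real N, real k / real N)) ` ({..N} \<times> {..N})"
    by (force simp: interior_mesh_def)
qed simp

text \<open>A full-length step never ends at an interior point of the square that carries no unknown. The
  factor \<open>1 / real N\<close> keeps the form of the step in \<^const>\<open>directional_diff\<close>.\<close>

lemma lattice_translate_in_mesh_or_frontier:
  fixes p q :: int
  assumes P: "P \<in> interior_mesh N"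
    and cl: "P + (of_int p * (1 / real N), of_int q * (1 / real N)) \<in> closure Omega"
  shows "P + (of_int p * (1 / real N), of_int q * (1 / real N)) \<in> interior_mesh N \<union> frontier Omega"
proof -
  obtain j k where jk: "P = (real j / real N, real k / real N)" "1 \<le> j" "j < N"
    using P by (auto simp: interior_mesh_def)
  define j' k' where "j' = int j + p" and "k' = int k + q"
  define Y where "Y = P + (of_int p * (1 / real N), of_int q * (1 / real N))"
  have N: "0 < real N" using jk by simp
  have Y: "Y = (of_int j' / real N, of_int k' / real N)"
    by (simp add: Y_def jk(1) j'_def k'_def add_divide_distrib)
  have "Y \<in> interior_mesh N" if "Y \<in> Omega"
  proof -
    have "0 < j'" "j' < int N" "0 < k'" "k' < int N"
      using that N by (auto simp: Y Omega_def field_simps)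
    then show ?thesis
      unfolding interior_mesh_def
      by (intro CollectI exI[of _ "nat j'"] exI[of _ "nat k'"]) (auto simp: Y)
  qed
  then show ?thesis
    using cl frontier_Omega by (auto simp: Y_def)
qed

text \<open>Before the first hit the ray is in the interior. After it there is no second hit, since the open
  segment from an interior point to a point of the closure of a convex set stays in the interior.\<close>

lemma ex1_exit_time:
  fixes S :: "'a::euclidean_space set"
  assumes "convex S" "bounded S" "P \<in> interior S" "e \<noteq> 0"
  shows "\<exists>!t. 0 < t \<and> P + t *\<^sub>R e \<in> frontier S"
proof -
  obtain t where t: "0 < t" "P + t *\<^sub>R e \<in> frontier S"
    and before: "\<And>r. 0 \<le> r \<Longrightarrow> r < t \<Longrightarrow> P + r *\<^sub>R e \<in> interior S"
    using ray_to_frontier[OF assms(2-4)] by blast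
  have "r = t" if r: "0 < r" "P + r *\<^sub>R e \<in> frontier S" for r
  proof (rule ccontr)
    assume "r \<noteq> t"
    then consider "r < t" | "t < r" by linarith
    then show False
    proof cases
      case 1
      then show False
        using before[of r] r by (simp add: frontier_def)
    next
      case 2
      have "P + t *\<^sub>R e \<in> open_segment P (P + r *\<^sub>R e)"
        using 2 t(1) r(1) assms(4)
        by (auto simp: in_segment algebra_simps intro!: exI[of _ "t / r"])
      moreover have "open_segment P (P + r *\<^sub>R e) \<subseteq> interior S"
        using r(2) by (intro in_interior_closure_convex_segment assms) (simp add: frontier_def)
      ultimately show False
        using t(2) by (auto simp: frontier_def)
    qed
  qed
  with t show ?thesis by blast
qed

text \<open>This justifies the definite description in \<^const>\<open>step_length\<close>: a truncated step has a positive
  length and ends at a boundary point, where the value is prescribed.\<close>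

lemma step_length_hits_mesh_or_frontier:
  fixes p q :: int and N :: nat
  defines "d \<equiv> (of_int p * (1 / real N), of_int q * (1 / real N))"
  assumes P: "P \<in> interior_mesh N" and d: "d \<noteq> 0" and e: "e = d /\<^sub>R norm d"
  shows "0 < step_length P e d"
    and "P + step_length P e d *\<^sub>R e \<in> interior_mesh N \<union> frontier Omega"
proof -
  have "0 < step_length P e d \<and> P + step_length P e d *\<^sub>R e \<in> interior_mesh N \<union> frontier Omega"
  proof (cases "P + d \<in> closure Omega")
    case True
    then have "step_length P e d *\<^sub>R e = d"
      using d by (simp add: step_length_def e del: scaleR_Pair)
    then show ?thesis
      using lattice_translate_in_mesh_or_frontier[OF P True[unfolded d_def], folded d_def] True d
      by (simp add: step_length_def)
  next
    case False
    have "convex Omega" "bounded Omega"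
      by (auto simp: Omega_def intro!: convex_Times bounded_Times)
    moreover have "P \<in> interior Omega"
      using P interior_mesh_subset_Omega open_Omega by (auto simp: interior_open)
    ultimately have "\<exists>!t. 0 < t \<and> P + t *\<^sub>R e \<in> frontier Omega"
      using d e by (intro ex1_exit_time) auto
    from theI'[OF this] show ?thesis
      using False by (simp add: step_length_def)
  qed
  then show "0 < step_length P e d"
    "P + step_length P e d *\<^sub>R e \<in> interior_mesh N \<union> frontier Omega" by auto
qed

definition central_weights ::
  "(real \<times> real \<Rightarrow> real) \<Rightarrow> real \<times> real \<Rightarrow> real \<Rightarrow> real \<Rightarrow> real \<times> real \<Rightarrow> (real \<times> (real \<times> real)) list"
where
  "central_weights \<gamma> e sp sm P =
     [(2 / (sp + sm) * \<gamma> (P + (sp / 2) *\<^sub>R e) / sp, P + sp *\<^sub>R e),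
      (2 / (sp + sm) * \<gamma> (P - (sm / 2) *\<^sub>R e) / sm, P - sm *\<^sub>R e)]"

lemma central_diff_eq_weighted_drop:
  "- central_diff \<gamma> e sp sm v P = weighted_drop (central_weights \<gamma> e sp sm P) v P"
  by (simp add: central_diff_def central_weights_def algebra_simps diff_divide_distrib)

lemma central_weights_nonneg:
  assumes "(w, Y) \<in> set (central_weights \<gamma> e sp sm P)" "0 < sp" "0 < sm"
    and "0 \<le> \<gamma> (P + (sp / 2) *\<^sub>R e)" "0 \<le> \<gamma> (P - (sm / 2) *\<^sub>R e)"
    and "P + sp *\<^sub>R e \<in> A" "P - sm *\<^sub>R e \<in> A"
  shows "0 \<le> w \<and> Y \<in> A"
proof -
  have "0 \<le> 2 / (sp + sm) * \<gamma> (P + (sp / 2) *\<^sub>R e) / sp" "0 \<le> 2 / (sp + sm) * \<gamma> (P - (sm / 2) *\<^sub>R e) / sm"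
    using assms(2-5) by (intro divide_nonneg_pos mult_nonneg_nonneg; simp)+
  with assms(1,6,7) show ?thesis
    unfolding central_weights_def by (auto simp del: scaleR_Pair)
qed

text \<open>The angle of an admissible direction is recovered from the slope by \<^const>\<open>arctan\<close>, because the
  horizontal component is positive.\<close>

lemma direction_arctan:
  fixes d :: "real \<times> real"
  assumes "0 < fst d"
  shows "direction (arctan (snd d / fst d)) = d /\<^sub>R norm d"
proof -
  obtain x y where d: "d = (x, y)" by force
  have x: "0 < x" using assms d by simp
  have "sqrt (1 + (y / x)\<^sup>2) = sqrt ((x\<^sup>2 + y\<^sup>2) / x\<^sup>2)"
    using x by (simp add: field_simps)
  also have "\<dots> = norm d / x"
    using x by (simp add: d norm_Pair real_sqrt_divide)
  finally have r: "sqrt (1 + (y / x)\<^sup>2) = norm d / x" .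
  have "cos (arctan (y / x)) = x / norm d" "sin (arctan (y / x)) = y / norm d"
    using x by (simp_all add: cos_arctan sin_arctan r)
  then show ?thesis
    by (simp add: direction_def d divide_inverse mult.commute)
qed

lemma directional_diff_eq_weighted_drop:
  fixes p q :: int
  assumes P: "P \<in> interior_mesh N" and p: "1 \<le> p" and \<gamma>: "\<And>X. 0 \<le> \<gamma> X"
  obtains ws where
    "\<And>v. - directional_diff (1 / real N) \<gamma> (arctan (of_int q / of_int p)) p q v P = weighted_drop ws v P"
    "\<And>w Y. (w, Y) \<in> set ws \<Longrightarrow> 0 \<le> w \<and> Y \<in> interior_mesh N \<union> frontier Omega"
proof -
  have N: "0 < real N" using P by (auto simp: interior_mesh_def)
  define d :: "real \<times> real" where "d = (of_int p * (1 / real N), of_int q * (1 / real N))"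
  define e where "e = direction (arctan (of_int q / of_int p))"
  have e: "e = d /\<^sub>R norm d"
    using direction_arctan[of d] N p by (simp add: e_def d_def)
  have d0: "d \<noteq> 0"
    using N p by (simp add: d_def zero_prod_def)
  define sp sm where "sp = step_length P e d" and "sm = step_length P (- e) (- d)"
  have minus_d: "- d = (of_int (- p) * (1 / real N), of_int (- q) * (1 / real N))"
    by (simp add: d_def)
  have plus: "0 < sp" "P + sp *\<^sub>R e \<in> interior_mesh N \<union> frontier Omega"
    using step_length_hits_mesh_or_frontier[OF P, of p q e] d0 e by (auto simp: sp_def d_def)
  have minus: "0 < sm" "P - sm *\<^sub>R e \<in> interior_mesh N \<union> frontier Omega"
    using step_length_hits_mesh_or_frontier[OF P, of "- p" "- q" "- e", folded minus_d] d0 e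
    by (auto simp: sm_def)
  show thesis
  proof (rule that[of "central_weights \<gamma> e sp sm P"])
    show "- directional_diff (1 / real N) \<gamma> (arctan (of_int q / of_int p)) p q v P =
        weighted_drop (central_weights \<gamma> e sp sm P) v P" for v
      by (simp only: directional_diff_def Let_def e_def[symmetric] d_def[symmetric]
          sp_def[symmetric] sm_def[symmetric] central_diff_eq_weighted_drop)
    show "0 \<le> w \<and> Y \<in> interior_mesh N \<union> frontier Omega"
      if "(w, Y) \<in> set (central_weights \<gamma> e sp sm P)" for w Y
      using central_weights_nonneg[OF that plus(1) minus(1) \<gamma> \<gamma> plus(2) minus(2)] .
  qed
qed

text \<open>The boundary function is split off with a minus sign: at mesh and boundary points,
  \<^const>\<open>with_boundary_values\<close> equals the extension of \<open>u\<close> by zero minus the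
  extension of \<open>- g\<close> by zero, so linearity moves the second part into the right-hand side.\<close>

lemma is_linear_system_if_weighted_drop:
  assumes eq: "\<And>u P. P \<in> interior_mesh N \<Longrightarrow>
      scheme_lhs D g N S u P = weighted_drop (ws P) (with_boundary_values g u) P"
    and nb: "\<And>P w Y. P \<in> interior_mesh N \<Longrightarrow> (w, Y) \<in> set (ws P) \<Longrightarrow>
      Y \<in> interior_mesh N \<union> frontier Omega"
  shows "is_linear_system D f g N S (\<lambda>P Q. weighted_drop (ws P) (indicator {Q}) P)
           (\<lambda>P. f P + weighted_drop (ws P) (\<lambda>X. - indicator (frontier Omega) X * g X) P)"
  unfolding is_linear_system_def
proof (intro allI ballI)
  fix u P
  assume P: "P \<in> interior_mesh N"
  let ?I = "interior_mesh N" and ?F = "frontier Omega"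
  have disj: "?I \<inter> ?F = {}"
    using interior_mesh_subset_Omega frontier_Omega by auto
  have "weighted_drop (ws P) (with_boundary_values g u) P =
      weighted_drop (ws P) (\<lambda>X. indicator ?I X * u X - (- indicator ?F X * g X)) P"
    unfolding weighted_drop_def
  proof (intro arg_cong[where f = sum_list] map_cong refl, clarify)
    fix w Y
    assume "(w, Y) \<in> set (ws P)"
    then have "Y \<in> ?I \<union> ?F" using nb P by blast
    then show "w * (with_boundary_values g u P - with_boundary_values g u Y) =
        w * (indicator ?I P * u P - (- indicator ?F P * g P) -
             (indicator ?I Y * u Y - (- indicator ?F Y * g Y)))"
      using P disj by (auto simp: with_boundary_values_def indicator_def)
  qed
  then show "scheme_lhs D g N S u P - f P =
      (\<Sum>Q\<in>?I. weighted_drop (ws P) (indicator {Q}) P * u Q) -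
      (f P + weighted_drop (ws P) (\<lambda>X. - indicator ?F X * g X) P)"
    unfolding eq[OF P] weighted_drop_diff weighted_drop_matrix_apply[OF finite_interior_mesh] by simp
qed

text \<open>The last clause provides the strictly weighted neighbour that the minimum principle needs, with the
  first coordinate as the rank.\<close>

definition monotone_weights ::
  "(real \<times> real \<Rightarrow> real^2^2) \<Rightarrow> (real \<times> real \<Rightarrow> real) \<Rightarrow> nat \<Rightarrow> (real \<times> real \<Rightarrow> stencil) \<Rightarrow>
   real \<times> real \<Rightarrow> (real \<times> (real \<times> real)) list \<Rightarrow> bool"
where
  "monotone_weights D g N S P ws \<longleftrightarrow>
     (\<forall>u. scheme_lhs D g N S u P = weighted_drop ws (with_boundary_values g u) P) \<and>
     (\<forall>w Y. (w, Y) \<in> set ws \<longrightarrow> 0 \<le> w \<and> Y \<in> interior_mesh N \<union> frontier Omega) \<and>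
     (\<exists>w Y. (w, Y) \<in> set ws \<and> 0 < w \<and> fst Y < fst P)"

lemma monotone_scheme_if_monotone_weights:
  assumes "\<forall>P\<in>interior_mesh N. \<exists>ws. monotone_weights D g N S P ws"
  shows "monotone_scheme D f g N S"
proof -
  let ?I = "interior_mesh N"
  obtain ws where mono: "\<And>P. P \<in> ?I \<Longrightarrow> monotone_weights D g N S P (ws P)"
    using assms by metis
  have ws: "scheme_lhs D g N S u P = weighted_drop (ws P) (with_boundary_values g u) P"
    "(w, Y) \<in> set (ws P) \<Longrightarrow> 0 \<le> w \<and> Y \<in> ?I \<union> frontier Omega"
    "\<exists>w Y. (w, Y) \<in> set (ws P) \<and> 0 < w \<and> fst Y < fst P" if "P \<in> ?I" for P u w Y
    using mono[OF that] unfolding monotone_weights_def by blast+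
  have "M_matrix_on ?I (\<lambda>P Q. weighted_drop (ws P) (indicator {Q}) P)"
  proof (rule weighted_drop_M_matrix[where rk = fst, OF finite_interior_mesh])
    show "0 \<le> w" if "P \<in> ?I" "(w, Y) \<in> set (ws P)" for P w Y
      using ws(2)[OF that] ..
    show "\<exists>w Y. (w, Y) \<in> set (ws P) \<and> 0 < w \<and> (Y \<in> ?I \<longrightarrow> fst Y < fst P)" if "P \<in> ?I" for P
      using ws(3)[OF that] by blast
  qed
  moreover have "is_linear_system D f g N S (\<lambda>P Q. weighted_drop (ws P) (indicator {Q}) P)
      (\<lambda>P. f P + weighted_drop (ws P) (\<lambda>X. - indicator (frontier Omega) X * g X) P)"
  proof (rule is_linear_system_if_weighted_drop)
    show "Y \<in> ?I \<union> frontier Omega" if "P \<in> ?I" "(w, Y) \<in> set (ws P)" for P w Y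
      using ws(2)[OF that] ..
  qed (rule ws(1))
  ultimately show ?thesis
    unfolding monotone_scheme_def by (intro exI conjI)
qed

section \<open>The choice of the slope\<close>

text \<open>The condition \<open>\<bar>b\<bar> / a < q / p < c / \<bar>b\<bar>\<close> near \<open>P\<close>, cleared of denominators so that it also makes
  sense for \<open>b = 0\<close>.\<close>

definition slope_separates ::
  "(real \<times> real \<Rightarrow> real^2^2) \<Rightarrow> real \<Rightarrow> real \<times> real \<Rightarrow> int \<Rightarrow> int \<Rightarrow> bool"
where
  "slope_separates D r P p q \<longleftrightarrow>
     (\<forall>X\<in>closure Omega. dist P X < r \<longrightarrow>
        \<bar>coeff_b D X\<bar> * of_int p < coeff_a D X * of_int q \<and>
        \<bar>coeff_b D X\<bar> * of_int q < coeff_c D X * of_int p)"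

lemma slope_separates_mono:
  "slope_separates D r P p q \<Longrightarrow> r' \<le> r \<Longrightarrow> slope_separates D r' P p q"
  by (auto simp: slope_separates_def)

text \<open>If \<open>b\<close> is below both \<open>a\<close> and \<open>c\<close>, the slope \<open>1\<close> works. Otherwise \<open>b\<^sup>2 < a c\<close> leaves exactly one of
  them at most \<open>b\<close>, say \<open>a \<le> b < c\<close>. With \<open>q = M\<close> the admissible \<open>p\<close> form the open interval from
  \<open>M b / c\<close> to \<open>M a / b\<close>, which lies in \<open>{0..M}\<close>. Its length is \<open>M (a c - b\<^sup>2) / (b c)\<close>, and
  \<open>M (a c - b\<^sup>2) \<ge> M \<alpha>' > \<alpha> \<ge> c (b + 1) > b c\<close>, so it contains an integer.\<close>

lemma rational_slope_exists:
  fixes a b c \<alpha> \<alpha>' :: real and M :: int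
  assumes "0 < a" "0 < c" "0 \<le> b" and det: "0 < \<alpha>'" "\<alpha>' \<le> a * c - b\<^sup>2"
    and up: "a * (b + 1) \<le> \<alpha>" "c * (b + 1) \<le> \<alpha>" and M: "1 \<le> M" "\<alpha> < M * \<alpha>'"
  obtains p q :: int where "1 \<le> p" "p \<le> M" "1 \<le> q" "q \<le> M" "b * p < a * q" "b * q < c * p"
proof -
  have one_sided: "\<exists>p\<ge>1. p \<le> M \<and> b * M < c * p \<and> b * real_of_int p < a * M"
    if ac: "0 < a" "0 < c" "a \<le> b" "b < c" "\<alpha>' \<le> a * c - b\<^sup>2" "c * (b + 1) \<le> \<alpha>" for a c
  proof -
    have b: "0 < b" using ac by linarith
    \<comment> \<open>the least integer above the left end of the interval\<close>
    define p where "p = \<lfloor>M * b / c\<rfloor> + 1"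
    have "M * b / c < p" "p \<le> M * b / c + 1"
      by (simp_all add: p_def floor_correct)
    have "c * b < M * \<alpha>'"
      using ac M(2) by (simp add: algebra_simps)
    also have "\<dots> \<le> M * (a * c - b\<^sup>2)"
      using ac M by (intro mult_left_mono) auto
    finally have "M * b / c + 1 < M * a / b"
      using b ac by (simp add: field_simps power2_eq_square)
    with \<open>p \<le> M * b / c + 1\<close> have p_up: "p < M * a / b" by linarith
    have "M * a / b \<le> M"
      using b ac M by (simp add: field_simps)
    with p_up have "p \<le> M" by linarith
    moreover have "0 \<le> M * b / c"
      using M b ac by simp
    with \<open>M * b / c < p\<close> have "1 \<le> p" by linarith
    moreover have "b * M < c * p"
      using \<open>M * b / c < p\<close> ac by (simp add: field_simps)
    moreover have "b * p < a * M"
      using p_up b by (simp add: field_simps)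
    ultimately show ?thesis by blast
  qed
  have "b\<^sup>2 < a * c" using det by linarith
  consider "b < a" "b < c" | "a \<le> b" "b < c" | "c \<le> b" "b < a" | "a \<le> b" "c \<le> b"
    by linarith
  then show thesis
  proof cases
    case 1
    then show ?thesis using that[of 1 1] M by simp
  next
    case 2
    then show ?thesis
      using one_sided[of a c] assms that[of _ M] by blast
  next
    case 3
    have "\<alpha>' \<le> c * a - b\<^sup>2" using det by (simp add: mult.commute)
    then show ?thesis
      using one_sided[of c a] 3 assms that[of M] by blast
  next
    case 4
    then have "a * c \<le> b\<^sup>2"
      unfolding power2_eq_square using assms by (intro mult_mono) auto
    with \<open>b\<^sup>2 < a * c\<close> show ?thesis by simp
  qed
qed

text \<open>The axis vectors bound the diagonal entries. The vector \<open>(- b, a)\<close> has the quadratic form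
  \<open>a (a c - b\<^sup>2)\<close>, and its squared norm is at least \<open>a\<^sup>2\<close>, which bounds the determinant.\<close>

lemma uniformly_pos_def_det:
  assumes upd: "uniformly_pos_def_on Omega D" and sym: "\<forall>X\<in>Omega. transpose (D X) = D X"
  obtains l where "0 < l"
    "\<And>X. X \<in> Omega \<Longrightarrow> l \<le> coeff_a D X"
    "\<And>X. X \<in> Omega \<Longrightarrow> l \<le> coeff_c D X"
    "\<And>X. X \<in> Omega \<Longrightarrow> l\<^sup>2 \<le> coeff_a D X * coeff_c D X - (coeff_b D X)\<^sup>2"
proof -
  obtain l where l: "0 < l"
    and form: "\<And>X \<xi>. X \<in> Omega \<Longrightarrow> l * (norm \<xi>)\<^sup>2 \<le> \<xi> \<bullet> (D X *v \<xi>)"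
    using upd unfolding uniformly_pos_def_on_def by blast
  have quad: "l * (s\<^sup>2 + t\<^sup>2) \<le> coeff_a D X * s\<^sup>2 + 2 * coeff_b D X * s * t + coeff_c D X * t\<^sup>2"
    if X: "X \<in> Omega" for X s t
  proof -
    have "transpose (D X) $ 2 $ 1 = D X $ 2 $ 1"
      using sym X by simp
    then have "D X $ 2 $ 1 = coeff_b D X"
      by (simp add: transpose_def coeff_b_def)
    moreover have "(norm (vector [s, t] :: real^2))\<^sup>2 = s\<^sup>2 + t\<^sup>2"
      by (simp only: power2_norm_eq_inner) (simp add: inner_vec_def sum_2 power2_eq_square)
    ultimately show ?thesis
      using form[OF X, of "vector [s, t]"]
      by (simp add: inner_vec_def matrix_vector_mult_def sum_2
          coeff_a_def coeff_b_def coeff_c_def power2_eq_square algebra_simps)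
  qed
  have a: "l \<le> coeff_a D X" and c: "l \<le> coeff_c D X" if "X \<in> Omega" for X
    using quad[OF that, of 1 0] quad[OF that, of 0 1] by simp_all
  have "l\<^sup>2 \<le> coeff_a D X * coeff_c D X - (coeff_b D X)\<^sup>2" if X: "X \<in> Omega" for X
  proof -
    let ?a = "coeff_a D X" and ?b = "coeff_b D X" and ?c = "coeff_c D X"
    have "?a * (l * ?a) \<le> l * ((- ?b)\<^sup>2 + ?a\<^sup>2)"
      using l by (simp add: power2_eq_square algebra_simps)
    also have "\<dots> \<le> ?a * (?a * ?c - ?b\<^sup>2)"
      using quad[OF X, of "- ?b" ?a] by (simp add: power2_eq_square algebra_simps)
    finally have "l * ?a \<le> ?a * ?c - ?b\<^sup>2"
      using a[OF X] l by (simp add: mult_le_cancel_left)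
    moreover have "l * l \<le> l * ?a"
      using a[OF X] l by simp
    ultimately show ?thesis by (simp add: power2_eq_square)
  qed
  with l a c that show thesis by blast
qed

text \<open>The pointwise slope depends on the point discontinuously, but it takes finitely many values. So a
  Lebesgue number of the induced open cover of the closed square gives one radius for all points. The
  bounds that define \<open>M\<close> are known on the open square and pass to its closure by continuity.\<close>

lemma uniform_slope_choice:
  fixes D :: "real \<times> real \<Rightarrow> real^2^2"
  assumes cont: "continuous_on (closure Omega) D"
    and sym: "\<forall>X\<in>Omega. transpose (D X) = D X"
    and upd: "uniformly_pos_def_on Omega D"
  defines "M \<equiv> \<lfloor>3 * alpha_upper D / alpha_lower D\<rfloor> + 1"
  shows "\<exists>\<delta>>0. \<forall>P\<in>closure Omega. \<exists>p\<in>{1..M}. \<exists>q\<in>{1..M}. slope_separates D \<delta> P p q"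
proof -
  let ?K = "closure Omega"
  let ?a = "coeff_a D" and ?b = "coeff_b D" and ?c = "coeff_c D"
  have K: "compact ?K"
    unfolding closure_Omega by (intro compact_Times compact_Icc)
  have ne: "Omega \<noteq> {}"
    by (auto simp: Omega_def)
  have cont_abc: "continuous_on ?K ?a" "continuous_on ?K ?b" "continuous_on ?K ?c"
    unfolding coeff_a_def coeff_b_def coeff_c_def by (intro continuous_intros cont)+
  obtain l where l: "0 < l"
    and la: "\<And>X. X \<in> Omega \<Longrightarrow> l \<le> ?a X" and lc: "\<And>X. X \<in> Omega \<Longrightarrow> l \<le> ?c X"
    and ldet: "\<And>X. X \<in> Omega \<Longrightarrow> l\<^sup>2 \<le> ?a X * ?c X - (?b X)\<^sup>2"
    using uniformly_pos_def_det[OF upd sym] by blast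
  have lower: "l\<^sup>2 \<le> alpha_lower D"
    unfolding alpha_lower_def using ne ldet by (intro cINF_greatest) auto
  with l have lower_pos: "0 < alpha_lower D"
    by (meson less_le_trans zero_less_power)
  have det_Omega: "alpha_lower D \<le> ?a X * ?c X - (?b X)\<^sup>2" if "X \<in> Omega" for X
    unfolding alpha_lower_def using that ldet by (intro cINF_lower bdd_belowI2) auto
  have bdd: "bdd_above (f ` Omega)" if "continuous_on ?K f" for f :: "real \<times> real \<Rightarrow> real"
    using compact_continuous_image[OF that K] closure_subset
    by (meson bdd_above_mono bounded_imp_bdd_above compact_imp_bounded image_mono)
  have a_Omega: "?a X * (\<bar>?b X\<bar> + 1) \<le> alpha_upper D"
    and c_Omega: "?c X * (\<bar>?b X\<bar> + 1) \<le> alpha_upper D" if "X \<in> Omega" for X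
  proof -
    have sup: "f X \<le> (SUP X\<in>Omega. f X)" if "continuous_on ?K f" for f :: "real \<times> real \<Rightarrow> real"
      using \<open>X \<in> Omega\<close> bdd[OF that] by (intro cSUP_upper)
    have "?a X * (\<bar>?b X\<bar> + 1) \<le> (SUP X\<in>Omega. ?a X * (\<bar>?b X\<bar> + 1))"
      "?c X * (\<bar>?b X\<bar> + 1) \<le> (SUP X\<in>Omega. ?c X * (\<bar>?b X\<bar> + 1))"
      by (rule sup, intro continuous_intros cont_abc)+
    then show "?a X * (\<bar>?b X\<bar> + 1) \<le> alpha_upper D" "?c X * (\<bar>?b X\<bar> + 1) \<le> alpha_upper D"
      unfolding alpha_upper_def by linarith+
  qed
  have on_K: "l \<le> ?a X" "l \<le> ?c X" "alpha_lower D \<le> ?a X * ?c X - (?b X)\<^sup>2"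
    "?a X * (\<bar>?b X\<bar> + 1) \<le> alpha_upper D" "?c X * (\<bar>?b X\<bar> + 1) \<le> alpha_upper D"
    if X: "X \<in> ?K" for X
    by (rule continuous_ge_on_closure[OF _ X] continuous_le_on_closure[OF _ X];
        intro continuous_intros cont_abc la lc det_Omega a_Omega c_Omega; assumption)+
  obtain X0 where X0: "X0 \<in> Omega" using ne by blast
  have "0 < ?a X0 * (\<bar>?b X0\<bar> + 1)"
    using la[OF X0] l by simp
  with a_Omega[OF X0] have upper_pos: "0 < alpha_upper D" by linarith
  have "0 \<le> 3 * alpha_upper D / alpha_lower D"
    using upper_pos lower_pos by simp
  then have M1: "1 \<le> M" by (simp add: M_def)
  have "3 * alpha_upper D / alpha_lower D < M"
    unfolding M_def by linarith
  then have "3 * alpha_upper D < M * alpha_lower D"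
    using lower_pos by (simp add: field_simps)
  then have M_gt: "alpha_upper D < M * alpha_lower D"
    using upper_pos by linarith

  define G where "G = (\<lambda>(p, q). {X \<in> ?K. \<bar>?b X\<bar> * real_of_int p < ?a X * real_of_int q \<and>
      \<bar>?b X\<bar> * real_of_int q < ?c X * real_of_int p})"
  \<comment> \<open>relatively open sets are extended to open ones, because the coefficients are continuous only on the closed square\<close>
  have "\<exists>U. open U \<and> U \<inter> ?K = G pq" for pq
  proof -
    obtain p q where pq: "pq = (p, q)" by force
    let ?f = "\<lambda>X. min (?a X * real_of_int q - \<bar>?b X\<bar> * real_of_int p)
                      (?c X * real_of_int p - \<bar>?b X\<bar> * real_of_int q)"
    have cont_f: "continuous_on ?K ?f"
      by (intro continuous_intros cont_abc)
    obtain U where "open U" "U \<inter> ?K = ?f -` {0<..} \<inter> ?K"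
      using continuous_on_open_invariant[THEN iffD1, rule_format, OF cont_f open_greaterThan] by blast
    then show ?thesis
      by (intro exI[of _ U]) (auto simp: G_def pq)
  qed
  then obtain U where U: "\<And>pq. open (U pq)" "\<And>pq. U pq \<inter> ?K = G pq"
    by metis
  have cover: "?K \<subseteq> \<Union> (U ` ({1..M} \<times> {1..M}))"
  proof
    fix X assume X: "X \<in> ?K"
    have "0 < ?a X" "0 < ?c X"
      using on_K[OF X] l by linarith+
    then obtain p q where "1 \<le> p" "p \<le> M" "1 \<le> q" "q \<le> M"
      "\<bar>?b X\<bar> * p < ?a X * q" "\<bar>?b X\<bar> * q < ?c X * p"
      using rational_slope_exists[of "?a X" "?c X" "\<bar>?b X\<bar>" "alpha_lower D" "alpha_upper D" M]
        on_K[OF X] lower_pos M1 M_gt by auto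
    moreover from this have "X \<in> U (p, q)"
      using X U(2)[of "(p, q)"] by (auto simp: G_def)
    ultimately show "X \<in> \<Union> (U ` ({1..M} \<times> {1..M}))" by force
  qed
  have "\<exists>\<delta>>0. \<forall>P\<in>?K. \<exists>V\<in>U ` ({1..M} \<times> {1..M}). ball P \<delta> \<subseteq> V"
  proof (rule Heine_Borel_lemma[OF K cover])
    show "open V" if "V \<in> U ` ({1..M} \<times> {1..M})" for V
      using that U(1) by auto
  next
    fix \<delta> :: real
    assume "0 < \<delta>" "\<And>P. P \<in> ?K \<Longrightarrow> \<exists>V\<in>U ` ({1..M} \<times> {1..M}). ball P \<delta> \<subseteq> V"
    then show ?thesis
      by (intro exI[of _ \<delta>] conjI ballI)
  qed
  then obtain \<delta> where \<delta>: "0 < \<delta>" "\<forall>P\<in>?K. \<exists>V\<in>U ` ({1..M} \<times> {1..M}). ball P \<delta> \<subseteq> V"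
    by (elim exE conjE)
  have "\<exists>p\<in>{1..M}. \<exists>q\<in>{1..M}. slope_separates D \<delta> P p q" if "P \<in> ?K" for P
  proof -
    from \<delta>(2) that have "\<exists>V\<in>U ` ({1..M} \<times> {1..M}). ball P \<delta> \<subseteq> V"
      by (rule bspec)
    then obtain p q where pq: "p \<in> {1..M}" "q \<in> {1..M}" "ball P \<delta> \<subseteq> U (p, q)"
      by (elim bexE imageE) auto
    have "X \<in> G (p, q)" if "X \<in> ?K" "dist P X < \<delta>" for X
      using that pq(3) U(2)[of "(p, q)"] by (auto simp: mem_ball)
    then have "slope_separates D \<delta> P p q"
      by (auto simp: slope_separates_def G_def)
    with pq(1,2) show ?thesis by (intro bexI)
  qed
  with \<delta>(1) show ?thesis by (intro exI[of _ \<delta>] conjI ballI)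
qed

section \<open>Symmetric stencils\<close>

text \<open>The second direction mirrors the first at the horizontal axis. This makes the axis coefficients
  depend on \<open>b\<close> only through \<open>\<bar>b\<bar>\<close>, so a change of sign of \<open>b\<close> between a mesh point and a half step is
  harmless.\<close>

definition symmetric_stencil :: "int \<Rightarrow> int \<Rightarrow> int \<Rightarrow> stencil" where
  "symmetric_stencil m p q =
     \<lparr>width = nat m, angle1 = arctan (of_int q / of_int p), angle2 = arctan (of_int (- q) / of_int p),
      run1 = p, rise1 = q, run2 = p, rise2 = - q\<rparr>"

lemma admissible_symmetric_stencil:
  assumes "m = \<lfloor>3 * alpha_upper D / alpha_lower D\<rfloor> + 1" "1 \<le> p" "p \<le> m" "1 \<le> q" "q \<le> m"
  shows "admissible_stencil D (symmetric_stencil m p q)"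
proof -
  define t where "t = arctan (of_int q / of_int p)"
  have "0 < t" "t < pi / 2"
    using assms(2,4) arctan_ubound by (auto simp: t_def)
  moreover have "tan t = of_int q / of_int p" "tan (- t) = of_int (- q) / of_int p"
    by (simp_all add: t_def tan_arctan)
  moreover have "1 \<le> nat m" "int (nat m) = m"
    using assms(2,3) by auto
  ultimately show ?thesis
    using assms unfolding admissible_stencil_def
    by (simp add: symmetric_stencil_def t_def[symmetric] arctan_minus)
qed

lemma gamma_symmetric_stencil:
  shows "gamma0 D (symmetric_stencil m p q) X = coeff_a D X - \<bar>coeff_b D X\<bar> * (of_int p / of_int q)"
    and "gamma2 D (symmetric_stencil m p q) X = coeff_c D X - \<bar>coeff_b D X\<bar> * (of_int q / of_int p)"
  by (auto simp: gamma0_def gamma2_def symmetric_stencil_def cot_altdef tan_arctan arctan_minus)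

text \<open>The product of cosine and sine has the sign of the angle, which matches the sign of \<open>b\<close> wherever
  the coefficient is not zero by definition. This holds at every point, so the long steps in the
  oblique directions impose no condition on the mesh size.\<close>

lemma gamma1_symmetric_stencil_nonneg:
  assumes "1 \<le> p" "1 \<le> q"
  shows "0 \<le> gamma1_plus D (symmetric_stencil m p q) X"
    and "0 \<le> gamma1_minus D (symmetric_stencil m p q) X"
proof -
  define t where "t = arctan (of_int q / of_int p)"
  have "0 < t" "t < pi / 2"
    using assms arctan_ubound by (auto simp: t_def)
  then have t: "0 < cos t * sin t"
    by (intro mult_pos_pos cos_gt_zero sin_gt_zero) auto
  have "angle1 (symmetric_stencil m p q) = t" "angle2 (symmetric_stencil m p q) = - t"
    by (simp_all add: symmetric_stencil_def t_def arctan_minus)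
  with t show "0 \<le> gamma1_plus D (symmetric_stencil m p q) X"
    "0 \<le> gamma1_minus D (symmetric_stencil m p q) X"
    by (auto simp: gamma1_plus_def gamma1_minus_def intro!: divide_nonneg_pos divide_nonpos_pos)
qed

text \<open>The axis coefficients are evaluated only at distance \<open>h / 2\<close> from \<open>P\<close>, where the slope condition
  makes them positive. The left neighbour carries the required positive weight.\<close>

lemma symmetric_stencil_monotone_weights:
  fixes D :: "real \<times> real \<Rightarrow> real^2^2" and N :: nat
  defines "I \<equiv> interior_mesh N" and "h \<equiv> 1 / real N"
  assumes P: "P \<in> I" and S: "S P = symmetric_stencil m p q" and pq: "1 \<le> p" "1 \<le> q"
    and slope: "slope_separates D h P p q"
  shows "\<exists>ws. monotone_weights D g N S P ws"
proof -
  let ?s = "symmetric_stencil m p q"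
  obtain j k where jk: "P = (real j / real N, real k / real N)" "1 \<le> j" "j < N" "1 \<le> k" "k < N"
    using P by (auto simp: I_def interior_mesh_def)
  have h: "0 < h" using jk by (simp add: h_def)
  have gamma_pos: "0 < gamma0 D ?s X" "0 < gamma2 D ?s X" if "X \<in> closure Omega" "dist P X < h" for X
    using slope that pq by (auto simp: slope_separates_def gamma_symmetric_stencil field_simps)
  have dist_half: "dist P (P + v) = norm v" "dist P (P - v) = norm v" for v :: "real \<times> real"
    by (simp_all add: dist_norm)
  have half_cl: "P + (h / 2) *\<^sub>R (1, 0) \<in> closure Omega" "P - (h / 2) *\<^sub>R (1, 0) \<in> closure Omega"
    "P + (h / 2) *\<^sub>R (0, 1) \<in> closure Omega" "P - (h / 2) *\<^sub>R (0, 1) \<in> closure Omega"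
    using jk(2-5) by (simp_all add: jk(1) closure_Omega h_def field_simps)
  have half: "0 < gamma0 D ?s (P + (h / 2) *\<^sub>R (1, 0))" "0 < gamma0 D ?s (P - (h / 2) *\<^sub>R (1, 0))"
    "0 < gamma2 D ?s (P + (h / 2) *\<^sub>R (0, 1))" "0 < gamma2 D ?s (P - (h / 2) *\<^sub>R (0, 1))"
    by (intro gamma_pos half_cl; use h in \<open>simp add: dist_half norm_Pair\<close>)+
  have shift: "P + h *\<^sub>R (1, 0) = P + (of_int 1 * (1 / real N), of_int 0 * (1 / real N))"
    "P - h *\<^sub>R (1, 0) = P + (of_int (- 1) * (1 / real N), of_int 0 * (1 / real N))"
    "P + h *\<^sub>R (0, 1) = P + (of_int 0 * (1 / real N), of_int 1 * (1 / real N))"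
    "P - h *\<^sub>R (0, 1) = P + (of_int 0 * (1 / real N), of_int (- 1) * (1 / real N))"
    by (simp_all add: jk(1) h_def)
  have full: "P + h *\<^sub>R (1, 0) \<in> I \<union> frontier Omega" "P - h *\<^sub>R (1, 0) \<in> I \<union> frontier Omega"
    "P + h *\<^sub>R (0, 1) \<in> I \<union> frontier Omega" "P - h *\<^sub>R (0, 1) \<in> I \<union> frontier Omega"
    unfolding I_def shift using jk(2-5)
    by (intro lattice_translate_in_mesh_or_frontier P[unfolded I_def];
        simp add: jk(1) closure_Omega field_simps)+
  have sel: "angle1 ?s = arctan (of_int q / of_int p)" "run1 ?s = p" "rise1 ?s = q"
    "angle2 ?s = arctan (of_int (- q) / of_int p)" "run2 ?s = p" "rise2 ?s = - q"
    by (simp_all add: symmetric_stencil_def)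
  obtain ws1 where ws1:
    "\<And>v. - directional_diff (1 / real N) (gamma1_plus D ?s) (arctan (of_int q / of_int p)) p q v P =
       weighted_drop ws1 v P"
    "\<And>w Y. (w, Y) \<in> set ws1 \<Longrightarrow> 0 \<le> w \<and> Y \<in> interior_mesh N \<union> frontier Omega"
    by (rule directional_diff_eq_weighted_drop[OF P[unfolded I_def] pq(1)
        gamma1_symmetric_stencil_nonneg(1)[OF pq], where q = "q"]) (assumption | rule that)+
  obtain ws2 where ws2:
    "\<And>v. - directional_diff (1 / real N) (gamma1_minus D ?s) (arctan (of_int (- q) / of_int p)) p (- q) v P =
       weighted_drop ws2 v P"
    "\<And>w Y. (w, Y) \<in> set ws2 \<Longrightarrow> 0 \<le> w \<and> Y \<in> interior_mesh N \<union> frontier Omega"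
    by (rule directional_diff_eq_weighted_drop[OF P[unfolded I_def] pq(1)
        gamma1_symmetric_stencil_nonneg(2)[OF pq], where q = "- q"]) (assumption | rule that)+
  let ?wx = "central_weights (gamma0 D ?s) (1, 0) h h P"
  let ?wy = "central_weights (gamma2 D ?s) (0, 1) h h P"
  show ?thesis
    unfolding monotone_weights_def I_def[symmetric]
  proof (rule exI[of _ "?wx @ ws1 @ ws2 @ ?wy"],
      rule conjI[OF allI conjI[OF allI[OF allI[OF impI]]]])
    show "scheme_lhs D g N S u P =
        weighted_drop (?wx @ ws1 @ ws2 @ ?wy) (with_boundary_values g u) P" for u
      unfolding weighted_drop_append ws1(1)[symmetric] ws2(1)[symmetric]
        central_diff_eq_weighted_drop[symmetric]
      by (simp only: scheme_lhs_def Let_def S h_def sel)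
    show "0 \<le> w \<and> Y \<in> I \<union> frontier Omega" if "(w, Y) \<in> set (?wx @ ws1 @ ws2 @ ?wy)" for w Y
      using that ws1(2)[of w Y, folded I_def] ws2(2)[of w Y, folded I_def]
        central_weights_nonneg[OF _ h h half(1,2)[THEN less_imp_le] full(1,2)]
        central_weights_nonneg[OF _ h h half(3,4)[THEN less_imp_le] full(3,4)]
      unfolding set_append by blast
    show "\<exists>w Y. (w, Y) \<in> set (?wx @ ws1 @ ws2 @ ?wy) \<and> 0 < w \<and> fst Y < fst P"
      using half(2) h
      \<comment> \<open>entry 1 of the horizontal weights belongs to the step to the left\<close>
      by (intro exI[of _ "fst (?wx ! 1)"] exI[of _ "snd (?wx ! 1)"]) (simp add: central_weights_def)
  qed
qed

theorem theorem3p1: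
  fixes D :: "real \<times> real \<Rightarrow> real^2^2"
    and f g :: "real \<times> real \<Rightarrow> real"
  assumes "continuous_on (closure Omega) D"
    and "\<forall>X\<in>Omega. transpose (D X) = D X"
    and "uniformly_pos_def_on Omega D"
  shows "\<exists>h0>0. \<forall>N::nat. N \<ge> 1 \<and> 1 / real N \<le> h0 \<longrightarrow>
           (\<exists>S :: real \<times> real \<Rightarrow> stencil.
              (\<forall>P\<in>interior_mesh N. admissible_stencil D (S P)) \<and>
              monotone_scheme D f g N S)"
proof -
  define M where "M = \<lfloor>3 * alpha_upper D / alpha_lower D\<rfloor> + 1"
  obtain \<delta> where \<delta>: "0 < \<delta>"
    and ex: "\<forall>P\<in>closure Omega. \<exists>p\<in>{1..M}. \<exists>q\<in>{1..M}. slope_separates D \<delta> P p q"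
    using uniform_slope_choice[OF assms] unfolding M_def by (elim exE conjE)
  obtain p q where pq: "\<And>P. P \<in> closure Omega \<Longrightarrow> p P \<in> {1..M} \<and> q P \<in> {1..M}"
    and slope: "\<And>P. P \<in> closure Omega \<Longrightarrow> slope_separates D \<delta> P (p P) (q P)"
    using ex by metis
  define S where "S P = symmetric_stencil M (p P) (q P)" for P
  have "(\<forall>P\<in>interior_mesh N. admissible_stencil D (S P)) \<and> monotone_scheme D f g N S"
    if N: "N \<ge> 1 \<and> 1 / real N \<le> \<delta>" for N :: nat
  proof
    have cl: "P \<in> closure Omega" if "P \<in> interior_mesh N" for P
      using that interior_mesh_subset_Omega closure_subset by blast
    show "\<forall>P\<in>interior_mesh N. admissible_stencil D (S P)"
      using pq[OF cl] M_def by (simp add: S_def admissible_symmetric_stencil)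
    show "monotone_scheme D f g N S"
    proof (intro monotone_scheme_if_monotone_weights ballI)
      fix P
      assume P: "P \<in> interior_mesh N"
      have "1 \<le> p P" "1 \<le> q P"
        using pq[OF cl[OF P]] by auto
      moreover have "slope_separates D (1 / real N) P (p P) (q P)"
        using slope_separates_mono[OF slope[OF cl[OF P]]] N by blast
      ultimately show "\<exists>ws. monotone_weights D g N S P ws"
        by (rule symmetric_stencil_monotone_weights[of P N S, OF P S_def])
    qed
  qed
  with \<delta> show ?thesis by blast
qed

end
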